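(* Consider the Random Actions (RA) model with $N$ agents, parameter $\alpha\in(0,1)$ and a row-stochastic trust matrix $W$ (not necessarily irreducible), and let $\{C_1,\dots,C_M\}$ be the poset (under $\preceq$) of strongly connected (irreducible) components of the network. (i) For each maximal element $C_s$ of the poset, almost surely all opinions $x_{t,i}$, $i\in C_s$, converge as $t\to\infty$ to a common limit, which is either $0$ or $1$. (ii) The RA model converges to consensus almost surely, i.e. there is a random vector $\mathbf{x}_\infty$ with values in $\{\mathbf{0},\mathbf{1}\}$ (the all-zeros and all-ones vectors in $\mathbb{R}^N$) such that $\mathbf{x}_t\to\mathbf{x}_\infty$ almost surely as $t\to\infty$, if and only if, almost surely, all maximal elements of the poset converge to the same value (i.e. the common limits in (i) coincide for all maximal elements).
   Context: $\mathbb{N}=\{1,2,\dots\}$. Random Actions (RA) model: there are $N$ agents, a constant $\alpha\in(0,1)$, and an $N\times N$ row-stochastic matrix $W=(w_{ij})$ (nonnegative entries, each row sums to $1$); $w_{ij}>0$ is regarded as a directed edge from $j$ to $i$. The initial opinion vector $\mathbf{x}_1$ is a random vector in $[0,1]^N$ with arbitrary distribution. For each $t\in\mathbb{N}$, conditionally on the history $(\mathbf{x}_1,\mathbf{a}_1,\dots,\mathbf{a}_{t-1})$ (which determines $\mathbf{x}_t$), the actions $a_{t,1},\dots,a_{t,N}\in\{0,1\}$ are independent with $a_{t,i}\sim\mathrm{Bernoulli}(x_{t,i})$, and opinions are updated by $\mathbf{x}_{t+1}=(1-\alpha)\mathbf{x}_t+\alpha W\mathbf{a}_t$. Thus $\mathbf{x}_t\in[0,1]^N$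 for all $t$. Components: two agents $i,j$ communicate if there is a directed path (possibly of length $0$) from $i$ to $j$ and one from $j$ to $i$. This is an equivalence relation; its classes $C_1,\dots,C_M$ are the strongly connected (irreducible) components. Write $C_r\preceq C_s$ if there is a directed path (possibly of length $0$) from an agent in $C_s$ to an agent in $C_r$. This is a partial order on $\{C_1,\dots,C_M\}$. A component $C_s$ is a maximal element if there is no $C_t\neq C_s$ with $C_s\preceq C_t$. *)

theory Defs
  imports "HOL-Probability.Probability"
begin

definition row_stochastic :: "real ^ 'n ^ 'n \<Rightarrow> bool" where
  "row_stochastic W \<longleftrightarrow> (\<forall>i j. 0 \<le> W $ i $ j) \<and> (\<forall>i. (\<Sum>j\<in>UNIV. W $ i $ j) = 1)"

text \<open>A pair \<open>(j, i)\<close> is a directed edge from \<open>j\<close> to \<open>i\<close>, that is, \<open>i\<close> puts weight on \<open>j\<close>.\<close>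

definition edges :: "real ^ 'n ^ 'n \<Rightarrow> ('n \<times> 'n) set" where
  "edges W = {(j, i). W $ i $ j > 0}"

definition communicating :: "real ^ 'n ^ 'n \<Rightarrow> ('n \<times> 'n) set" where
  "communicating W = {(i, j). (i, j) \<in> (edges W)\<^sup>* \<and> (j, i) \<in> (edges W)\<^sup>*}"

definition components :: "real ^ 'n ^ 'n \<Rightarrow> 'n set set" where
  "components W = UNIV // communicating W"

definition comp_le :: "real ^ 'n ^ 'n \<Rightarrow> 'n set \<Rightarrow> 'n set \<Rightarrow> bool" where
  "comp_le W C D \<longleftrightarrow> (\<exists>j\<in>D. \<exists>i\<in>C. (j, i) \<in> (edges W)\<^sup>*)"

definition maximal_component :: "real ^ 'n ^ 'n \<Rightarrow> 'n set \<Rightarrow> bool" where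
  "maximal_component W C \<longleftrightarrow>
     C \<in> components W \<and> \<not> (\<exists>D\<in>components W. D \<noteq> C \<and> comp_le W C D)"

definition cond_indep_vars ::
  "'w measure \<Rightarrow> 'w measure \<Rightarrow> ('i \<Rightarrow> 'b measure) \<Rightarrow> ('i \<Rightarrow> 'w \<Rightarrow> 'b) \<Rightarrow> 'i set \<Rightarrow> bool" where
  "cond_indep_vars M F N X I \<longleftrightarrow>
     (\<forall>i\<in>I. X i \<in> M \<rightarrow>\<^sub>M N i) \<and>
     (\<forall>J\<subseteq>I. J \<noteq> {} \<longrightarrow> finite J \<longrightarrow> (\<forall>A\<in>Pi J (\<lambda>j. sets (N j)).
        AE \<omega> in M.
          real_cond_exp M F (indicator {\<omega>\<in>space M. \<forall>j\<in>J. X j \<omega> \<in> A j}) \<omega> =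
          (\<Prod>j\<in>J. real_cond_exp M F (indicator {\<omega>\<in>space M. X j \<omega> \<in> A j}) \<omega>)))"

text \<open>The \<open>\<sigma>\<close>-algebra generated by \<open>x 1\<close> and \<open>a 1, \<dots>, a (t - 1)\<close>.\<close>

definition history ::
  "'w measure \<Rightarrow> (nat \<Rightarrow> 'w \<Rightarrow> real ^ 'n) \<Rightarrow> (nat \<Rightarrow> 'w \<Rightarrow> real ^ 'n) \<Rightarrow> nat \<Rightarrow> 'w measure" where
  "history M x a t = sigma (space M)
     ({x 1 -` B \<inter> space M | B. B \<in> sets borel} \<union>
      {a s -` B \<inter> space M | s B. 1 \<le> s \<and> s < t \<and> B \<in> sets borel})"

text \<open>Time starts at \<open>1\<close>; the values \<open>x 0\<close> and \<open>a 0\<close> are irrelevant. As actions only take the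
  values \<open>0\<close> and \<open>1\<close>, their conditional law is determined by the conditional probability of \<open>1\<close>.\<close>

locale random_actions = prob_space M
  for M :: "'w measure" +
  fixes \<alpha> :: real
    and W :: "real ^ 'n ^ 'n"
    and x :: "nat \<Rightarrow> 'w \<Rightarrow> real ^ 'n"
    and a :: "nat \<Rightarrow> 'w \<Rightarrow> real ^ 'n"
  assumes alpha: "0 < \<alpha>" "\<alpha> < 1"
    and stochastic: "row_stochastic W"
    and initial_measurable: "x 1 \<in> borel_measurable M"
    and initial_range: "\<omega> \<in> space M \<Longrightarrow> x 1 \<omega> $ i \<in> {0..1}"
    and action_measurable: "t \<ge> 1 \<Longrightarrow> a t \<in> borel_measurable M"
    and action_range: "t \<ge> 1 \<Longrightarrow> \<omega> \<in> space M \<Longrightarrow> a t \<omega> $ i \<in> {0, 1}"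
    and action_indep: "t \<ge> 1 \<Longrightarrow>
      cond_indep_vars M (history M x a t) (\<lambda>_. borel) (\<lambda>i \<omega>. a t \<omega> $ i) UNIV"
    and action_bernoulli: "t \<ge> 1 \<Longrightarrow>
      AE \<omega> in M. real_cond_exp M (history M x a t) (indicator {\<omega>\<in>space M. a t \<omega> $ i = 1}) \<omega>
                 = x t \<omega> $ i"
    and update: "t \<ge> 1 \<Longrightarrow> \<omega> \<in> space M \<Longrightarrow>
      x (Suc t) \<omega> = (1 - \<alpha>) *\<^sub>R x t \<omega> + \<alpha> *\<^sub>R (W *v a t \<omega>)"

end

theory Submission
  imports Defs
begin

text \<open>On a maximal component a stationary weight vector turns the opinions into a bounded martingale
  whose increments are sums of orthogonal noise terms \<open>a t - x t\<close>. Hence the noise is square summable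
  in expectation and tends to 0 almost surely; as actions are 0 or 1 and a step is shorter than
  \<open>\<alpha> < 1\<close>, each action is eventually constant and each opinion converges to that constant \<open>c i\<close>.
  Passing to the limit in the update shows that \<open>c\<close> is harmonic with values in \<open>{0, 1}\<close>, so it is
  constant along edges. Once all maximal components act constantly as \<open>c\<close>, the remaining agents form
  a strictly substochastic system for the distance to \<open>c\<close>, which therefore dies out.\<close>

section \<open>Components and weights\<close>

lemma mem_own_component: "j \<in> communicating W `` {j}"
  by (auto simp: communicating_def)

lemma component_mem: "communicating W `` {j} \<in> components W"
  by (auto simp: components_def quotient_def)

lemma maximal_component_strongly_connected:
  assumes "maximal_component W C" "i \<in> C" "j \<in> C"
  shows "(i, j) \<in> (edges W)\<^sup>*"
proof -
  obtain k where "C = communicating W `` {k}"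
    using assms(1) by (auto simp: maximal_component_def components_def quotient_def)
  then show ?thesis using assms(2,3) by (auto simp: communicating_def intro: rtrancl_trans)
qed

lemma maximal_component_nonempty:
  assumes "maximal_component W C"
  shows "C \<noteq> {}"
  using assms mem_own_component
  by (fastforce simp: maximal_component_def components_def quotient_def)

text \<open>In \<open>comp_le\<close> the larger component lies upstream, so the class of any agent
  with a path into \<open>C\<close> is above \<open>C\<close>. Maximality makes that class
  \<open>C\<close> itself: agents of \<open>C\<close> listen only to agents of
  \<open>C\<close>.\<close>

lemma maximal_component_closed:
  assumes "maximal_component W C" "j \<in> C" "(i, j) \<in> (edges W)\<^sup>*"
  shows "i \<in> C"
proof -
  have "comp_le W C (communicating W `` {i})"
    using assms mem_own_component by (auto simp: comp_le_def)
  then have "communicating W `` {i} = C"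
    using assms(1) component_mem[of W i] unfolding maximal_component_def by metis
  then show ?thesis using mem_own_component[of i W] by simp
qed

text \<open>Choose an ancestor of \<open>i\<close> whose own ancestor set is smallest. Each of its
  ancestors has a subset of that set as ancestors, equal to it by minimality, and is therefore
  reached back. So nothing outside its class lies upstream of it.\<close>

lemma reachable_from_maximal_component:
  fixes W :: "real ^ 'n ^ 'n"
  obtains C j where "maximal_component W C" "j \<in> C" "(j, i) \<in> (edges W)\<^sup>*"
proof -
  define A where "A j = {k. (k, j) \<in> (edges W)\<^sup>*}" for j
  define j where "j = arg_min (\<lambda>j. card (A j)) (\<lambda>j. j \<in> A i)"
  have "i \<in> A i" by (simp add: A_def)
  then have j: "j \<in> A i" and min: "\<And>k. k \<in> A i \<Longrightarrow> card (A j) \<le> card (A k)"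
    unfolding j_def by (auto intro: arg_min_natI arg_min_nat_le)
  have rev_path: "(j, k) \<in> (edges W)\<^sup>*" if k: "k \<in> A j" for k
  proof -
    have "A k \<subseteq> A j" using k unfolding A_def by (blast intro: rtrancl_trans)
    moreover have "k \<in> A i" using j k unfolding A_def by (blast intro: rtrancl_trans)
    ultimately have "A k = A j" using min by (metis card_seteq finite)
    then show ?thesis by (auto simp: A_def)
  qed
  let ?C = "communicating W `` {j}"
  have "D = ?C" if DC: "D \<in> components W" "comp_le W ?C D" for D
  proof -
    obtain d where D: "D = communicating W `` {d}"
      using DC(1) by (auto simp: components_def quotient_def)
    obtain k i where k: "k \<in> D" and i: "i \<in> ?C" and ki: "(k, i) \<in> (edges W)\<^sup>*"
      using DC(2) by (auto simp: comp_le_def)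
    have "(k, j) \<in> (edges W)\<^sup>*"
      using i ki unfolding communicating_def by (blast intro: rtrancl_trans)
    then have "(j, k) \<in> communicating W"
      using rev_path by (simp add: communicating_def A_def)
    then show ?thesis
      using k unfolding D communicating_def by (blast intro: rtrancl_trans)
  qed
  then have "maximal_component W ?C"
    using component_mem by (auto simp: maximal_component_def)
  then show ?thesis using that[of ?C j] j mem_own_component by (auto simp: A_def)
qed

text \<open>Brouwer's theorem for \<open>p \<mapsto> p v* W\<close> on the simplex of distributions
  on \<open>C\<close>. No edge enters \<open>C\<close> from outside, so this simplex is mapped into
  itself; strong connectivity then makes the fixed point positive on all of
  \<open>C\<close>.\<close>

lemma stationary_weights_on_maximal_component:
  fixes W :: "real ^ 'n ^ 'n"
  assumes W: "row_stochastic W" and C: "maximal_component W C"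
  obtains p :: "real ^ 'n" where "p v* W = p" "\<And>i. i \<in> C \<Longrightarrow> 0 < p $ i"
    "\<And>i. 0 \<le> p $ i" "(\<Sum>i\<in>UNIV. p $ i) = 1"
proof -
  have W0: "0 \<le> W $ i $ j" and W1: "(\<Sum>j\<in>UNIV. W $ i $ j) = 1" for i j
    using W by (auto simp: row_stochastic_def)
  \<comment> \<open>The support is confined to \<open>C\<close>, since otherwise the fixed point
    could live on a different maximal component.\<close>
  define S where "S = {p :: real ^ 'n. (\<forall>i. 0 \<le> p $ i) \<and> (\<forall>i. i \<notin> C \<longrightarrow> p $ i = 0) \<and> (\<Sum>i\<in>UNIV. p $ i) = 1}"
  have S_bound: "p $ i \<le> 1" "0 \<le> p $ i" if "p \<in> S" for p i
  proof -
    show "0 \<le> p $ i" using that by (auto simp: S_def)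
    have "p $ i \<le> (\<Sum>i\<in>UNIV. p $ i)" using that by (intro member_le_sum) (auto simp: S_def)
    then show "p $ i \<le> 1" using that by (auto simp: S_def)
  qed
  have "S \<subseteq> cbox 0 (vec 1)" using S_bound by (auto simp: mem_box_cart)
  then have "bounded S" using bounded_cbox bounded_subset by blast
  moreover have "closed S"
    unfolding S_def
    by (intro closed_Collect_conj closed_Collect_all closed_Collect_imp open_Collect_const
        closed_Collect_le closed_Collect_eq continuous_intros)
  ultimately have "compact S" by (simp add: compact_eq_bounded_closed)
  moreover have "convex S"
    by (rule convexI) (auto simp: S_def sum.distrib simp flip: sum_distrib_left)
  moreover have "S \<noteq> {}"
  proof -
    obtain i where "i \<in> C" using maximal_component_nonempty[OF C] by blast
    then have "axis i 1 \<in> S" by (auto simp: S_def axis_def)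
    then show ?thesis by blast
  qed
  moreover have "continuous_on S (\<lambda>p. p v* W)"
    unfolding vector_matrix_mult_def by (intro continuous_intros)
  moreover have "(\<lambda>p. p v* W) \<in> S \<rightarrow> S"
  proof
    fix p assume p: "p \<in> S"
    have "0 \<le> (p v* W) $ j" for j
      using S_bound[OF p] W0 by (auto simp: vector_matrix_mult_def intro!: sum_nonneg)
    moreover have "(p v* W) $ j = 0" if "j \<notin> C" for j
    proof -
      have "p $ i * W $ i $ j = 0" for i
      proof (cases "i \<in> C")
        case True
        then have "(j, i) \<notin> edges W" using maximal_component_closed[OF C] that by blast
        then show ?thesis using W0[of i j] by (auto simp: edges_def)
      qed (use p in \<open>simp add: S_def\<close>)
      then show ?thesis unfolding vector_matrix_mult_def by (simp add: sum.neutral del: mult_eq_0_iff)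
    qed
    moreover have "(\<Sum>j\<in>UNIV. (p v* W) $ j) = 1"
    proof -
      have "(\<Sum>j\<in>UNIV. (p v* W) $ j) = (\<Sum>i\<in>UNIV. \<Sum>j\<in>UNIV. p $ i * W $ i $ j)"
        unfolding vector_matrix_mult_def by (subst sum.swap) simp
      also have "\<dots> = 1" using p W1 by (simp add: S_def flip: sum_distrib_left)
      finally show ?thesis .
    qed
    ultimately show "p v* W \<in> S" by (simp add: S_def)
  qed
  ultimately obtain p where p: "p \<in> S" and stat: "p v* W = p" by (rule brouwer)
  \<comment> \<open>Stationarity carries positivity upstream along an edge, so a single positive
    entry spreads over all of \<open>C\<close>.\<close>
  have step: "0 < p $ j" if "(j, i) \<in> edges W" "0 < p $ i" for i j
  proof -
    have "0 < p $ i * W $ i $ j" using that by (auto simp: edges_def)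
    also have "\<dots> \<le> (\<Sum>i\<in>UNIV. p $ i * W $ i $ j)"
      using S_bound[OF p] W0 by (intro member_le_sum) auto
    also have "\<dots> = (p v* W) $ j" by (simp add: vector_matrix_mult_def)
    finally show ?thesis by (simp add: stat)
  qed
  have pos_path: "0 < p $ j" if "(j, i) \<in> (edges W)\<^sup>*" "0 < p $ i" for i j
    using that by (induction rule: converse_rtrancl_induct) (auto intro: step)
  have "\<exists>i. p $ i \<noteq> 0"
  proof (rule ccontr)
    assume "\<not> ?thesis"
    then show False using p by (simp add: S_def)
  qed
  then obtain i where i: "0 < p $ i" using S_bound(2)[OF p, of _] by (metis less_eq_real_def)
  then have "i \<in> C" using p by (force simp: S_def)
  then have "0 < p $ j" if "j \<in> C" for j
    using pos_path i maximal_component_strongly_connected[OF C] that by blast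
  then show ?thesis using that[of p] stat p by (auto simp: S_def)
qed

text \<open>With \<open>d i\<close> the distance from \<open>R\<close> to \<open>i\<close>, the witness is \<open>h i = 1 - \<epsilon> ^ d i\<close>: a single edge
  from distance \<open>d i - 1\<close> of weight more than \<open>\<epsilon>\<close> already makes the average of \<open>h\<close> smaller.\<close>

lemma contracting_weights_outside:
  fixes W :: "real ^ 'n ^ 'n"
  assumes W: "row_stochastic W" and reach: "\<And>i. \<exists>j\<in>R. (j, i) \<in> (edges W)\<^sup>*"
  obtains h :: "'n \<Rightarrow> real" and \<delta> where "0 < \<delta>" "\<delta> < 1" "\<And>i. i \<notin> R \<Longrightarrow> 0 < h i"
    "\<And>i. i \<notin> R \<Longrightarrow> (\<Sum>j\<in>-R. W $ i $ j * h j) \<le> (1 - \<delta>) * h i"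
proof -
  have W0: "0 \<le> W $ i $ j" and W1: "(\<Sum>j\<in>UNIV. W $ i $ j) = 1" for i j
    using W by (auto simp: row_stochastic_def)
  define d where "d i = (LEAST n. \<exists>j\<in>R. (j, i) \<in> edges W ^^ n)" for i
  have ex: "\<exists>n. \<exists>j\<in>R. (j, i) \<in> edges W ^^ n" for i
    using reach[of i] by (auto simp: rtrancl_power)
  have d: "\<exists>j\<in>R. (j, i) \<in> edges W ^^ d i" for i
    unfolding d_def using LeastI_ex[OF ex[of i]] .
  have d_le: "d i \<le> n" if "j \<in> R" "(j, i) \<in> edges W ^^ n" for i j n
    unfolding d_def using that by (intro Least_le) blast
  have d_R: "d i = 0 \<longleftrightarrow> i \<in> R" for i
    proof
    show "i \<in> R" if "d i = 0" using d[of i] that by simp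
    show "d i = 0" if "i \<in> R" using d_le[OF that, of i 0] by simp
  qed
  \<comment> \<open>The last edge of a shortest path from \<open>R\<close> leaves an agent whose
    distance is exactly one less.\<close>
  have pred: "\<exists>k. 0 < W $ i $ k \<and> d i = Suc (d k)" if i: "i \<notin> R" for i
  proof -
    obtain n where n: "d i = Suc n" using d_R[of i] i by (cases "d i") auto
    obtain j where j: "j \<in> R" "(j, i) \<in> edges W ^^ Suc n" using d[of i] unfolding n by blast
    from j(2) obtain k where k: "(j, k) \<in> edges W ^^ n" "(k, i) \<in> edges W" by (rule relpow_Suc_E)
    obtain l where l: "l \<in> R" "(l, k) \<in> edges W ^^ d k" using d by blast
    have "d i \<le> Suc (d k)" using l(1) relpow_Suc_I[OF l(2) k(2)] by (rule d_le)
    moreover have "d k \<le> n" using j(1) k(1) by (rule d_le)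
    ultimately show ?thesis using n k(2) by (intro exI[of _ k]) (simp add: edges_def)
  qed
  \<comment> \<open>Halving puts \<open>\<epsilon>\<close> strictly below every positive entry of
    \<open>W\<close>; the inserted 1 keeps it at most 1/2.\<close>
  define \<epsilon> where "\<epsilon> = Min (insert 1 ((\<lambda>(i, j). W $ i $ j) ` {(i, j). 0 < W $ i $ j})) / 2"
  have \<epsilon>_le: "2 * \<epsilon> \<le> 1" "0 < W $ i $ j \<Longrightarrow> 2 * \<epsilon> \<le> W $ i $ j" for i j
    unfolding \<epsilon>_def by (auto intro!: Min_le)
  have "0 < \<epsilon>" unfolding \<epsilon>_def by (auto simp: Min_gr_iff)
  then have \<epsilon>: "0 < \<epsilon>" "\<epsilon> < 1" using \<epsilon>_le(1) by auto
  have \<epsilon>W: "\<epsilon> < W $ i $ j" if "0 < W $ i $ j" for i j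
    using \<epsilon>_le(2)[OF that] \<epsilon>(1) by linarith
  define h where "h i = 1 - \<epsilon> ^ d i" for i
  have h_R: "h i = 0" if "i \<in> R" for i
    using d_R[of i] that by (simp add: h_def)
  have h_pos: "0 < h i" if "i \<notin> R" for i
    using \<epsilon> that d_R[of i] by (simp add: h_def power_less_one_iff)
  have less: "(\<Sum>j\<in>-R. W $ i $ j * h j) < h i" if i: "i \<notin> R" for i
  proof -
    obtain k where k: "0 < W $ i $ k" "d i = Suc (d k)" using pred[OF i] by blast
    \<comment> \<open>As \<open>h\<close> vanishes on \<open>R\<close>, the sum may run over all
      agents, and the row sum 1 splits off the constant part of \<open>h\<close>.\<close>
    have "(\<Sum>j\<in>-R. W $ i $ j * h j) = (\<Sum>j\<in>UNIV. W $ i $ j * h j)"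
      using h_R by (intro sum.mono_neutral_left) auto
    also have "\<dots> = 1 - (\<Sum>j\<in>UNIV. W $ i $ j * \<epsilon> ^ d j)"
      by (simp add: h_def right_diff_distrib sum_subtractf W1)
    also have "(\<Sum>j\<in>UNIV. W $ i $ j * \<epsilon> ^ d j) \<ge> W $ i $ k * \<epsilon> ^ d k"
      using W0 \<epsilon> by (intro member_le_sum) auto
    moreover have "W $ i $ k * \<epsilon> ^ d k > \<epsilon> ^ d i"
      using \<epsilon>W[OF k(1)] \<epsilon> k(2) by simp
    ultimately show ?thesis by (simp add: h_def)
  qed
  \<comment> \<open>The least relative gap over the finitely many agents outside \<open>R\<close>;
    the inserted 1/2 keeps it below 1 and the minimum defined when \<open>R\<close> contains every
    agent.\<close>
  define \<delta> where "\<delta> = Min (insert (1/2) ((\<lambda>i. 1 - (\<Sum>j\<in>-R. W $ i $ j * h j) / h i) ` (-R)))"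
  show ?thesis
  proof (rule that)
    show "0 < \<delta>" unfolding \<delta>_def using less h_pos by (subst Min_gr_iff) auto
    have "\<delta> \<le> 1 / 2" unfolding \<delta>_def by (intro Min_le) auto
    then show "\<delta> < 1" by simp
    show "0 < h i" if "i \<notin> R" for i by (rule h_pos[OF that])
    show "(\<Sum>j\<in>-R. W $ i $ j * h j) \<le> (1 - \<delta>) * h i" if i: "i \<notin> R" for i
    proof -
      have "\<delta> \<le> 1 - (\<Sum>j\<in>-R. W $ i $ j * h j) / h i"
        unfolding \<delta>_def using i by (intro Min_le) auto
      then show ?thesis using h_pos[OF i] by (simp add: field_simps)
    qed
  qed
qed

section \<open>Limits\<close>

text \<open>Passing from an action 0 to an action 1 while staying close to the opinion is impossible,
  because one update moves an opinion by at most \<open>\<alpha> < 1\<close>.\<close>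

lemma action_eventually_constant:
  fixes x a :: "nat \<Rightarrow> real"
  assumes \<alpha>: "0 < \<alpha>" "\<alpha> < 1"
    and a: "\<And>t. a t \<in> {0, 1}" and lim: "(\<lambda>t. a t - x t) \<longlonglongrightarrow> 0"
    and step: "\<And>t. (1 - \<alpha>) * x t \<le> x (Suc t)" "\<And>t. x (Suc t) \<le> (1 - \<alpha>) * x t + \<alpha>"
  obtains c where "c \<in> {0, 1}" "eventually (\<lambda>t. a t = c) sequentially" "x \<longlonglongrightarrow> c"
proof -
  define \<epsilon> where "\<epsilon> = (1 - \<alpha>) / 2"
  have "0 < \<epsilon>" using \<alpha> by (simp add: \<epsilon>_def)
  then obtain T where T: "\<And>t. t \<ge> T \<Longrightarrow> \<bar>a t - x t\<bar> < \<epsilon>"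
    using LIMSEQ_D[OF lim] by fastforce
  \<comment> \<open>An opinion within \<open>\<epsilon>\<close> of 0 cannot come within
    \<open>\<epsilon>\<close> of 1 in one update. Rearranged, the same inequality excludes the jump
    from 1 to 0.\<close>
  have "(1 - \<alpha>) * \<epsilon> + \<alpha> < 1 - \<epsilon>"
  proof -
    have "(1 - \<alpha>) * (1 - \<alpha>) < 1 - \<alpha>" using \<alpha> by simp
    then show ?thesis by (simp add: \<epsilon>_def field_simps)
  qed
  note key = this
  have next_eq: "a (Suc t) = a t" if t: "t \<ge> T" for t
  proof -
    have b: "\<bar>a t - x t\<bar> < \<epsilon>" "\<bar>a (Suc t) - x (Suc t)\<bar> < \<epsilon>" using T t by auto
    consider "a (Suc t) = a t" | "a t = 0" "a (Suc t) = 1" | "a t = 1" "a (Suc t) = 0"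
      using a[of t] a[of "Suc t"] by auto
    then show ?thesis
    proof cases
      case 2
      have "(1 - \<alpha>) * x t \<le> (1 - \<alpha>) * \<epsilon>" using 2 b \<alpha> by (intro mult_left_mono) auto
      then show ?thesis using 2 b step(2)[of t] key by simp
    next
      case 3
      have "(1 - \<alpha>) * (1 - \<epsilon>) \<le> (1 - \<alpha>) * x t" using 3 b \<alpha> by (intro mult_left_mono) auto
      then show ?thesis using 3 b step(1)[of t] key by (simp add: algebra_simps)
    qed
  qed
  have const: "a t = a T" if "t \<ge> T" for t
    using that by (induction rule: dec_induct) (auto simp: next_eq)
  then have ev: "eventually (\<lambda>t. a t = a T) sequentially"
    by (rule eventually_sequentiallyI)
  have "a \<longlonglongrightarrow> a T" using ev by (rule tendsto_eventually)
  from tendsto_diff[OF this lim] have "x \<longlonglongrightarrow> a T" by simp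
  then show ?thesis using that a ev by blast
qed

text \<open>Integral and series of nonnegative terms commute, so the series has finite expectation.
  It is then almost surely finite, and the terms of a convergent series vanish in the limit.\<close>

lemma (in finite_measure) AE_tendsto_zero_of_bounded_expectation_sums:
  fixes f :: "nat \<Rightarrow> 'a \<Rightarrow> real"
  assumes int: "\<And>n. integrable M (f n)" and nonneg: "\<And>n \<omega>. \<omega> \<in> space M \<Longrightarrow> 0 \<le> f n \<omega>"
    and bound: "\<And>n. (\<Sum>k<n. integral\<^sup>L M (f k)) \<le> K"
  shows "AE \<omega> in M. (\<lambda>n. f n \<omega>) \<longlonglongrightarrow> 0"
proof -
  have [measurable]: "f n \<in> borel_measurable M" for n using int by auto
  have nn: "(\<integral>\<^sup>+\<omega>. ennreal (f n \<omega>) \<partial>M) = ennreal (integral\<^sup>L M (f n))" for n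
    using int nonneg by (intro nn_integral_eq_integral) auto
  have int0: "0 \<le> integral\<^sup>L M (f n)" for n
    using nonneg by (intro integral_nonneg_AE) auto
  have "(\<integral>\<^sup>+\<omega>. (\<Sum>n. ennreal (f n \<omega>)) \<partial>M) = (\<Sum>n. ennreal (integral\<^sup>L M (f n)))"
    by (subst nn_integral_suminf) (auto simp: nn)
  also have "\<dots> \<le> ennreal K"
    using bound int0 by (intro suminf_le_const) (auto simp: sum_ennreal intro!: ennreal_leI)
  finally have "(\<integral>\<^sup>+\<omega>. (\<Sum>n. ennreal (f n \<omega>)) \<partial>M) \<noteq> \<infinity>"
    by (auto simp: top_unique)
  then have "AE \<omega> in M. (\<Sum>n. ennreal (f n \<omega>)) \<noteq> \<infinity>"
    by (intro nn_integral_PInf_AE) auto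
  then show ?thesis using AE_space
  proof eventually_elim
    case (elim \<omega>)
    then have "summable (\<lambda>n. f n \<omega>)"
      using nonneg by (intro summable_suminf_not_top) auto
    then show ?case by (rule summable_LIMSEQ_zero)
  qed
qed

section \<open>Random actions\<close>

lemma space_history [simp]: "space (history M x a t) = space M"
  by (simp add: history_def space_measure_of_conv)

lemma sets_history:
  "sets (history M x a t) = sigma_sets (space M)
     ({x 1 -` B \<inter> space M | B. B \<in> sets borel} \<union>
      {a s -` B \<inter> space M | s B. 1 \<le> s \<and> s < t \<and> B \<in> sets borel})"
  unfolding history_def by (rule sets_measure_of) auto

lemma sets_history_mono:
  assumes "s \<le> t"
  shows "sets (history M x a s) \<subseteq> sets (history M x a t)"
  unfolding sets_history
proof (intro sigma_sets_mono' Un_mono subset_refl subsetI)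
  fix A assume "A \<in> {a r -` B \<inter> space M | r B. 1 \<le> r \<and> r < s \<and> B \<in> sets borel}"
  then obtain r B where "A = a r -` B \<inter> space M" "1 \<le> r" "r < s" "B \<in> sets borel" by blast
  moreover from this assms have "r < t" by linarith
  ultimately show "A \<in> {a r -` B \<inter> space M | r B. 1 \<le> r \<and> r < t \<and> B \<in> sets borel}" by blast
qed

lemma action_measurable_history:
  fixes a :: "nat \<Rightarrow> 'w \<Rightarrow> real ^ 'n"
  assumes "1 \<le> s" "s < t"
  shows "a s \<in> borel_measurable (history M x a t)"
proof (rule measurableI)
  fix B :: "(real ^ 'n) set" assume "B \<in> sets borel"
  then show "a s -` B \<inter> space (history M x a t) \<in> sets (history M x a t)"
    unfolding space_history sets_history using assms by (intro sigma_sets.Basic) blast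
qed simp

lemma (in finite_measure) integrable_bounded:
  fixes f :: "'a \<Rightarrow> real"
  assumes "f \<in> borel_measurable M" "\<And>\<omega>. \<omega> \<in> space M \<Longrightarrow> \<bar>f \<omega>\<bar> \<le> B"
  shows "integrable M f"
  using assms by (intro integrable_const_bound[of f B]) auto

lemma vec_nth_measurable [measurable (raw)]:
  fixes f :: "'b \<Rightarrow> real ^ 'n"
  assumes "f \<in> borel_measurable N"
  shows "(\<lambda>\<omega>. f \<omega> $ i) \<in> borel_measurable N"
proof -
  have "(\<lambda>v :: real ^ 'n. v $ i) \<in> borel_measurable borel"
    by (intro borel_measurable_continuous_onI continuous_intros)
  from measurable_compose[OF assms this] show ?thesis .
qed

context random_actions
begin

section \<open>Measurability and bounds for opinions and actions\<close>

lemma W_nonneg: "0 \<le> W $ i $ j" and W_row_sum: "(\<Sum>j\<in>UNIV. W $ i $ j) = 1"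
  using stochastic by (auto simp: row_stochastic_def)

lemma update_component:
  assumes "1 \<le> t" "\<omega> \<in> space M"
  shows "x (Suc t) \<omega> $ i = (1 - \<alpha>) * x t \<omega> $ i + \<alpha> * (\<Sum>j\<in>UNIV. W $ i $ j * a t \<omega> $ j)"
  using update[OF assms] by (simp add: matrix_vector_mult_def)

lemma subalgebra_history: "subalgebra M (history M x a t)"
  unfolding subalgebra_def
proof
  have "{x 1 -` B \<inter> space M | B. B \<in> sets borel} \<union>
      {a s -` B \<inter> space M | s B. 1 \<le> s \<and> s < t \<and> B \<in> sets borel} \<subseteq> sets M"
    using initial_measurable action_measurable by (auto intro: measurable_sets)
  then show "sets (history M x a t) \<subseteq> sets M"
    unfolding sets_history by (rule sets.sigma_sets_subset)
qed simp

lemma measurable_of_history: "f \<in> borel_measurable (history M x a t) \<Longrightarrow> f \<in> borel_measurable M"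
  by (rule measurable_from_subalg[OF subalgebra_history])

text \<open>By the update, \<open>x t\<close> is a function of \<open>x 1\<close> and the actions
  strictly before \<open>t\<close>. It is thus known before the actions at \<open>t\<close> are
  drawn and may serve as a multiplier in conditional expectations.\<close>

lemma opinion_measurable_history:
  assumes "1 \<le> t"
  shows "x t \<in> borel_measurable (history M x a t)"
  using assms
proof (induction t rule: dec_induct)
  case base
  show ?case
  proof (rule measurableI)
    fix B :: "(real ^ 'n) set" assume "B \<in> sets borel"
    then show "x 1 -` B \<inter> space (history M x a 1) \<in> sets (history M x a 1)"
      unfolding space_history sets_history by (intro sigma_sets.Basic) blast
  qed simp
next
  case (step t)
  let ?H = "history M x a (Suc t)"
  have [measurable]: "x t \<in> borel_measurable ?H"
    using sets_history_mono[of t "Suc t" M x a]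
    by (intro subsetD[OF measurable_mono step.IH]) auto
  have a_meas: "a t \<in> borel_measurable ?H"
    using step.hyps by (intro action_measurable_history) auto
  have "(\<lambda>v. W *v v) \<in> borel_measurable borel"
    by (intro borel_measurable_continuous_onI linear_continuous_on)
      (simp add: linear_conv_bounded_linear[symmetric])
  from measurable_compose[OF a_meas this] have "(\<lambda>\<omega>. W *v a t \<omega>) \<in> borel_measurable ?H" .
  then have "(\<lambda>\<omega>. (1 - \<alpha>) *\<^sub>R x t \<omega> + \<alpha> *\<^sub>R (W *v a t \<omega>)) \<in> borel_measurable ?H"
    by simp
  then show ?case
    using step.hyps by (subst measurable_cong[OF update]) auto
qed

lemma opinion_measurable [measurable]: "1 \<le> t \<Longrightarrow> x t \<in> borel_measurable M"
  by (rule measurable_of_history[OF opinion_measurable_history])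

lemma action_bounds:
  assumes "1 \<le> t" "\<omega> \<in> space M"
  shows "0 \<le> a t \<omega> $ i" "a t \<omega> $ i \<le> 1"
  using action_range[OF assms, of i] by auto

text \<open>The averaged action lies between 0 and 1. These are the one-step bounds required by
  \<open>action_eventually_constant\<close>.\<close>

lemma update_bounds:
  assumes "1 \<le> t" "\<omega> \<in> space M"
  shows "(1 - \<alpha>) * x t \<omega> $ i \<le> x (Suc t) \<omega> $ i"
    "x (Suc t) \<omega> $ i \<le> (1 - \<alpha>) * x t \<omega> $ i + \<alpha>"
proof -
  let ?s = "\<Sum>j\<in>UNIV. W $ i $ j * a t \<omega> $ j"
  have "0 \<le> ?s" using action_bounds[OF assms] W_nonneg by (intro sum_nonneg) auto
  moreover have "?s \<le> (\<Sum>j\<in>UNIV. W $ i $ j * 1)"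
    using action_bounds[OF assms] W_nonneg by (intro sum_mono mult_left_mono) auto
  ultimately show "(1 - \<alpha>) * x t \<omega> $ i \<le> x (Suc t) \<omega> $ i"
    "x (Suc t) \<omega> $ i \<le> (1 - \<alpha>) * x t \<omega> $ i + \<alpha>"
    using alpha by (auto simp: update_component[OF assms] W_row_sum)
qed

lemma opinion_bounds:
  assumes "1 \<le> t" "\<omega> \<in> space M"
  shows "0 \<le> x t \<omega> $ i" "x t \<omega> $ i \<le> 1"
proof -
  have "x t \<omega> $ i \<in> {0..1}"
    using assms(1)
  proof (induction t rule: dec_induct)
    case base
    then show ?case using initial_range assms(2) by blast
  next
    case (step t)
    have "0 \<le> (1 - \<alpha>) * x t \<omega> $ i" "(1 - \<alpha>) * x t \<omega> $ i \<le> (1 - \<alpha>) * 1"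
      using step.IH alpha by (intro mult_nonneg_nonneg mult_left_mono; simp)+
    then show ?case
      using update_bounds[OF step.hyps(1) assms(2), of i] by auto
  qed
  then show "0 \<le> x t \<omega> $ i" "x t \<omega> $ i \<le> 1" by auto
qed

lemma sigma_finite_subalgebra_history: "sigma_finite_subalgebra M (history M x a t)"
  by (intro finite_measure_subalgebra_is_sigma_finite finite_measure_subalgebra.intro
      finite_measure_subalgebra_axioms.intro subalgebra_history) unfold_locales

section \<open>First and second moments of actions and noise\<close>

text \<open>A 0/1 action is the indicator of the event that it equals 1, whose conditional
  probability is the opinion. The multiplier \<open>g\<close> is known to the history and passes
  through the conditional expectation.\<close>

lemma expectation_times_action:
  assumes t: "1 \<le> t" and g: "g \<in> borel_measurable (history M x a t)"
    and bound: "\<And>\<omega>. \<omega> \<in> space M \<Longrightarrow> \<bar>g \<omega>\<bar> \<le> 1"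
  shows "expectation (\<lambda>\<omega>. g \<omega> * a t \<omega> $ i) = expectation (\<lambda>\<omega>. g \<omega> * x t \<omega> $ i)"
proof -
  note [measurable] = action_measurable[OF t]
  have gM[measurable]: "g \<in> borel_measurable M" using g by (rule measurable_of_history)
  let ?A = "{\<omega> \<in> space M. a t \<omega> $ i = 1}"
  have "expectation (\<lambda>\<omega>. g \<omega> * a t \<omega> $ i) = expectation (\<lambda>\<omega>. g \<omega> * indicator ?A \<omega>)"
    using action_range[OF t, of _ i]
    by (intro Bochner_Integration.integral_cong) (auto simp: indicator_def)
  also have "\<dots> = expectation (\<lambda>\<omega>. g \<omega> * real_cond_exp M (history M x a t) (indicator ?A) \<omega>)"
  proof (rule sigma_finite_subalgebra.real_cond_exp_intg(2)[OF sigma_finite_subalgebra_history _ g, symmetric])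
    show "integrable M (\<lambda>\<omega>. g \<omega> * indicator ?A \<omega>)"
      using bound by (intro integrable_bounded[of _ 1]) (auto simp: indicator_def)
  qed simp
  also have "\<dots> = expectation (\<lambda>\<omega>. g \<omega> * x t \<omega> $ i)"
    using t action_bernoulli[OF t, of i]
      measurable_of_history[OF borel_measurable_cond_exp]
    by (intro integral_cong_AE) auto
  finally show ?thesis .
qed

text \<open>The product of two actions is the indicator of a joint event. Conditional independence
  factors its conditional probability, and the Bernoulli law identifies the factors as
  opinions.\<close>

lemma expectation_action_product:
  assumes t: "1 \<le> t" and ij: "i \<noteq> j"
  shows "expectation (\<lambda>\<omega>. a t \<omega> $ i * a t \<omega> $ j) = expectation (\<lambda>\<omega>. x t \<omega> $ i * x t \<omega> $ j)"
proof -
  note [measurable] = action_measurable[OF t]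
  let ?H = "history M x a t"
  \<comment> \<open>Membership in \<open>{1}\<close> replaces equality so that the event matches the
    form in \<open>cond_indep_vars\<close> with all \<open>A k\<close> equal to
    \<open>{1}\<close>.\<close>
  let ?A = "{\<omega> \<in> space M. \<forall>k\<in>{i, j}. a t \<omega> $ k \<in> {1}}"
  have "AE \<omega> in M. real_cond_exp M ?H (indicator ?A) \<omega> =
      (\<Prod>k\<in>{i, j}. real_cond_exp M ?H (indicator {\<omega>\<in>space M. a t \<omega> $ k \<in> {1}}) \<omega>)"
    using action_indep[OF t] unfolding cond_indep_vars_def
    by (elim conjE allE[of _ "{i, j}"] impE ballE[of _ _ "\<lambda>_. {1}"]) auto
  then have AE: "AE \<omega> in M. real_cond_exp M ?H (indicator ?A) \<omega> = x t \<omega> $ i * x t \<omega> $ j"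
    using action_bernoulli[OF t, of i] action_bernoulli[OF t, of j]
    by eventually_elim (use ij in simp)
  have "expectation (\<lambda>\<omega>. a t \<omega> $ i * a t \<omega> $ j) = expectation (indicator ?A)"
    using action_range[OF t, of _ i] action_range[OF t, of _ j]
    by (intro Bochner_Integration.integral_cong) (auto simp: indicator_def)
  also have "\<dots> = expectation (real_cond_exp M ?H (indicator ?A))"
  proof (rule sigma_finite_subalgebra.real_cond_exp_int(2)[OF sigma_finite_subalgebra_history, symmetric])
    show "integrable M (indicator ?A :: _ \<Rightarrow> real)"
      by (intro integrable_bounded[of _ 1]) (auto simp: indicator_def)
  qed
  also have "\<dots> = expectation (\<lambda>\<omega>. x t \<omega> $ i * x t \<omega> $ j)"
    using t AE measurable_of_history[OF borel_measurable_cond_exp]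
    by (intro integral_cong_AE) auto
  finally show ?thesis .
qed

lemma noise_bound:
  assumes "1 \<le> t" "\<omega> \<in> space M"
  shows "\<bar>a t \<omega> $ i - x t \<omega> $ i\<bar> \<le> 1"
  using action_bounds[OF assms, of i] opinion_bounds[OF assms, of i] by linarith

text \<open>The martingale difference property of the noise, tested against bounded multipliers
  known to the history.\<close>

lemma noise_orthogonal_history:
  assumes t: "1 \<le> t" and g: "g \<in> borel_measurable (history M x a t)"
    and bound: "\<And>\<omega>. \<omega> \<in> space M \<Longrightarrow> \<bar>g \<omega>\<bar> \<le> 1"
  shows "expectation (\<lambda>\<omega>. g \<omega> * (a t \<omega> $ i - x t \<omega> $ i)) = 0"
proof -
  note [measurable] = action_measurable[OF t] opinion_measurable[OF t] measurable_of_history[OF g]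
  have prod: "\<bar>g \<omega> * y\<bar> \<le> 1" if "\<omega> \<in> space M" "0 \<le> y" "y \<le> 1" for \<omega> y
    using bound[OF that(1)] that mult_mono[of "\<bar>g \<omega>\<bar>" 1 "\<bar>y\<bar>" 1] by (simp add: abs_mult)
  have "integrable M (\<lambda>\<omega>. g \<omega> * a t \<omega> $ i)"
    using prod action_bounds[OF t] by (intro integrable_bounded[of _ 1]) auto
  moreover have "integrable M (\<lambda>\<omega>. g \<omega> * x t \<omega> $ i)"
    using prod opinion_bounds[OF t] by (intro integrable_bounded[of _ 1]) auto
  ultimately show ?thesis
    using expectation_times_action[OF assms] by (simp add: right_diff_distrib)
qed

text \<open>Expand the product into \<open>a i * a j - x i * x j\<close> minus \<open>x j\<close>
  times noise \<open>i\<close> and \<open>x i\<close> times noise \<open>j\<close>. The first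
  difference has mean 0 by conditional independence, the other terms because opinions are known to
  the history.\<close>

lemma noise_orthogonal:
  assumes t: "1 \<le> t" and ij: "i \<noteq> j"
  shows "expectation (\<lambda>\<omega>. (a t \<omega> $ i - x t \<omega> $ i) * (a t \<omega> $ j - x t \<omega> $ j)) = 0"
proof -
  note [measurable] = action_measurable[OF t] opinion_measurable[OF t]
  let ?d = "\<lambda>\<omega> i. a t \<omega> $ i - x t \<omega> $ i"
  note b = action_bounds[OF t] opinion_bounds[OF t]
  have int: "integrable M (\<lambda>\<omega>. u \<omega> * v \<omega>)"
    if "u \<in> borel_measurable M" "v \<in> borel_measurable M"
      "\<And>\<omega>. \<omega> \<in> space M \<Longrightarrow> \<bar>u \<omega>\<bar> \<le> 1" "\<And>\<omega>. \<omega> \<in> space M \<Longrightarrow> \<bar>v \<omega>\<bar> \<le> 1"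
    for u v :: "'w \<Rightarrow> real"
    using that by (intro integrable_bounded[of _ 1]) (auto simp: abs_mult intro: mult_le_one)
  have "expectation (\<lambda>\<omega>. ?d \<omega> i * ?d \<omega> j) =
      expectation (\<lambda>\<omega>. (a t \<omega> $ i * a t \<omega> $ j - x t \<omega> $ i * x t \<omega> $ j)
        - x t \<omega> $ j * ?d \<omega> i - x t \<omega> $ i * ?d \<omega> j)"
    by (intro Bochner_Integration.integral_cong) (auto simp: algebra_simps)
  also have "\<dots> = (expectation (\<lambda>\<omega>. a t \<omega> $ i * a t \<omega> $ j) - expectation (\<lambda>\<omega>. x t \<omega> $ i * x t \<omega> $ j))
      - expectation (\<lambda>\<omega>. x t \<omega> $ j * ?d \<omega> i) - expectation (\<lambda>\<omega>. x t \<omega> $ i * ?d \<omega> j)"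
    using b noise_bound[OF t]
    by (subst Bochner_Integration.integral_diff | intro Bochner_Integration.integrable_diff int | simp)+
  also have "\<dots> = 0"
    using b opinion_measurable_history[OF t]
    by (simp add: expectation_action_product[OF t ij] noise_orthogonal_history[OF t])
  finally show ?thesis .
qed

text \<open>Pythagoras: the noise terms of distinct agents are orthogonal, so only the diagonal of
  the squared sum survives.\<close>

lemma expectation_square_weighted_noise:
  fixes p :: "real ^ 'n"
  assumes t: "1 \<le> t"
  shows "expectation (\<lambda>\<omega>. (\<Sum>i\<in>UNIV. p $ i * (a t \<omega> $ i - x t \<omega> $ i))\<^sup>2) =
    (\<Sum>i\<in>UNIV. (p $ i)\<^sup>2 * expectation (\<lambda>\<omega>. (a t \<omega> $ i - x t \<omega> $ i)\<^sup>2))"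
proof -
  note [measurable] = action_measurable[OF t] opinion_measurable[OF t]
  let ?d = "\<lambda>i \<omega>. a t \<omega> $ i - x t \<omega> $ i"
  have int: "integrable M (\<lambda>\<omega>. ?d i \<omega> * ?d j \<omega>)" for i j
    using noise_bound[OF t] by (intro integrable_bounded[of _ 1]) (auto simp: abs_mult intro: mult_le_one)
  have "expectation (\<lambda>\<omega>. (\<Sum>i\<in>UNIV. p $ i * ?d i \<omega>)\<^sup>2) =
      expectation (\<lambda>\<omega>. \<Sum>i\<in>UNIV. \<Sum>j\<in>UNIV. p $ i * p $ j * (?d i \<omega> * ?d j \<omega>))"
    by (intro Bochner_Integration.integral_cong)
      (simp_all add: power2_eq_square sum_product algebra_simps del: mult_minus_right)
  also have "\<dots> = (\<Sum>i\<in>UNIV. \<Sum>j\<in>UNIV. p $ i * p $ j * expectation (\<lambda>\<omega>. ?d i \<omega> * ?d j \<omega>))"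
    using int by simp
  also have "\<dots> = (\<Sum>i\<in>UNIV. \<Sum>j\<in>UNIV. if j = i then (p $ i)\<^sup>2 * expectation (\<lambda>\<omega>. (?d i \<omega>)\<^sup>2) else 0)"
    using noise_orthogonal[OF t] by (intro sum.cong) (auto simp: power2_eq_square)
  finally show ?thesis by simp
qed

section \<open>Finite total noise and convergence on a maximal component\<close>

text \<open>Stationarity of \<open>p\<close> makes the weighted opinion a bounded martingale; its second moment grows
  by the second moments of the orthogonal noise terms, whose total is therefore finite.\<close>

lemma noise_variance_sum_le:
  fixes p :: "real ^ 'n"
  assumes stationary: "p v* W = p" and p: "\<And>i. 0 \<le> p $ i" "(\<Sum>i\<in>UNIV. p $ i) = 1"
  shows "(\<alpha> * p $ i)\<^sup>2 * (\<Sum>k<n. expectation (\<lambda>\<omega>. (a (Suc k) \<omega> $ i - x (Suc k) \<omega> $ i)\<^sup>2)) \<le> 1"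
proof -
  let ?d = "\<lambda>i t \<omega>. a t \<omega> $ i - x t \<omega> $ i"
  define m where "m t \<omega> = (\<Sum>i\<in>UNIV. p $ i * x t \<omega> $ i)" for t \<omega>
  define z where "z t \<omega> = (\<Sum>i\<in>UNIV. p $ i * ?d i t \<omega>)" for t \<omega>
  have m_bounds: "0 \<le> m t \<omega>" "m t \<omega> \<le> 1" if "1 \<le> t" "\<omega> \<in> space M" for t \<omega>
  proof -
    show "0 \<le> m t \<omega>" unfolding m_def using p opinion_bounds[OF that] by (intro sum_nonneg) auto
    have "m t \<omega> \<le> (\<Sum>i\<in>UNIV. p $ i * 1)"
      unfolding m_def using p opinion_bounds[OF that] by (intro sum_mono mult_left_mono) auto
    then show "m t \<omega> \<le> 1" using p by simp
  qed
  have z_bound: "\<bar>z t \<omega>\<bar> \<le> 1" if "1 \<le> t" "\<omega> \<in> space M" for t \<omega>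
  proof -
    have "\<bar>z t \<omega>\<bar> \<le> (\<Sum>i\<in>UNIV. \<bar>p $ i * ?d i t \<omega>\<bar>)" unfolding z_def by (rule sum_abs)
    also have "\<dots> \<le> (\<Sum>i\<in>UNIV. p $ i * 1)"
      unfolding abs_mult using p noise_bound[OF that] by (intro sum_mono mult_mono) auto
    finally show ?thesis using p by simp
  qed
  \<comment> \<open>After swapping sums, \<open>p v* W = p\<close> turns the average of
    \<open>W *v a t\<close> into that of \<open>a t\<close>, so \<open>m\<close> moves by
    \<open>\<alpha>\<close> times the averaged noise.\<close>
  have m_step: "m (Suc t) \<omega> = m t \<omega> + \<alpha> * z t \<omega>" if "1 \<le> t" "\<omega> \<in> space M" for t \<omega>
  proof -
    have "(\<Sum>i\<in>UNIV. p $ i * (\<Sum>j\<in>UNIV. W $ i $ j * a t \<omega> $ j)) = (\<Sum>j\<in>UNIV. (p v* W) $ j * a t \<omega> $ j)"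
      unfolding vector_matrix_mult_def
      by (simp add: sum_distrib_left sum_distrib_right mult.assoc) (rule sum.swap)
    then have pWa: "(\<Sum>i\<in>UNIV. p $ i * (\<Sum>j\<in>UNIV. W $ i $ j * a t \<omega> $ j)) = (\<Sum>j\<in>UNIV. p $ j * a t \<omega> $ j)"
      by (simp add: stationary)
    have "m (Suc t) \<omega> = (1 - \<alpha>) * m t \<omega> + \<alpha> * (\<Sum>i\<in>UNIV. p $ i * (\<Sum>j\<in>UNIV. W $ i $ j * a t \<omega> $ j))"
      unfolding m_def update_component[OF that]
      by (simp add: distrib_left sum.distrib sum_distrib_left mult.left_commute)
    then show ?thesis
      unfolding pWa m_def z_def by (simp add: right_diff_distrib left_diff_distrib sum_subtractf)
  qed
  have meas: "m t \<in> borel_measurable (history M x a t)" if "1 \<le> t" for t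
    using opinion_measurable_history[OF that] unfolding m_def by measurable
  have moment: "expectation (\<lambda>\<omega>. (m (Suc t) \<omega>)\<^sup>2) = expectation (\<lambda>\<omega>. (m t \<omega>)\<^sup>2) +
      \<alpha>\<^sup>2 * (\<Sum>i\<in>UNIV. (p $ i)\<^sup>2 * expectation (\<lambda>\<omega>. (?d i t \<omega>)\<^sup>2))" if t: "1 \<le> t" for t
  proof -
    note [measurable] = action_measurable[OF t] opinion_measurable[OF t]
    have mz[measurable]: "m t \<in> borel_measurable M" "z t \<in> borel_measurable M"
      unfolding m_def z_def by measurable
    have bounds: "\<bar>m t \<omega>\<bar> \<le> 1" "\<bar>z t \<omega>\<bar> \<le> 1" if "\<omega> \<in> space M" for \<omega>
      using m_bounds[OF t that] z_bound[OF t that] by auto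
    have int: "integrable M (\<lambda>\<omega>. u \<omega> * v \<omega>)"
      if "u \<in> {m t, z t}" "v \<in> {m t, z t}" for u v
      using that bounds mz
      by (intro integrable_bounded[of _ 1]) (auto simp: abs_mult intro!: mult_le_one)
    have int_md: "integrable M (\<lambda>\<omega>. m t \<omega> * ?d i t \<omega>)" for i
      using bounds noise_bound[OF t]
      by (intro integrable_bounded[of _ 1]) (auto simp: abs_mult intro!: mult_le_one)
    have "expectation (\<lambda>\<omega>. m t \<omega> * z t \<omega>) = (\<Sum>i\<in>UNIV. p $ i * expectation (\<lambda>\<omega>. m t \<omega> * ?d i t \<omega>))"
      using int_md by (simp add: z_def sum_distrib_left mult.left_commute)
    \<comment> \<open>\<open>m t\<close> is known to the history at \<open>t\<close>, hence
      orthogonal to each noise term at \<open>t\<close>.\<close>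
    then have cross: "expectation (\<lambda>\<omega>. m t \<omega> * z t \<omega>) = 0"
      using noise_orthogonal_history[OF t meas[OF t] bounds(1)] by simp
    have "expectation (\<lambda>\<omega>. (m (Suc t) \<omega>)\<^sup>2) =
        expectation (\<lambda>\<omega>. m t \<omega> * m t \<omega> + 2 * \<alpha> * (m t \<omega> * z t \<omega>) + \<alpha>\<^sup>2 * (z t \<omega> * z t \<omega>))"
      by (intro Bochner_Integration.integral_cong)
        (simp_all add: m_step[OF t] power2_eq_square algebra_simps)
    also have "\<dots> = expectation (\<lambda>\<omega>. m t \<omega> * m t \<omega>) + \<alpha>\<^sup>2 * expectation (\<lambda>\<omega>. z t \<omega> * z t \<omega>)"
      using int by (simp add: cross)
    finally show ?thesis
      using expectation_square_weighted_noise[OF t, of p] by (simp add: power2_eq_square z_def)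
  qed
  \<comment> \<open>Telescoping starts at time 1, so the increment with index \<open>k\<close>
    belongs to time \<open>Suc k\<close>.\<close>
  have "expectation (\<lambda>\<omega>. (m (Suc n) \<omega>)\<^sup>2) = expectation (\<lambda>\<omega>. (m 1 \<omega>)\<^sup>2) +
      (\<Sum>k<n. \<alpha>\<^sup>2 * (\<Sum>i\<in>UNIV. (p $ i)\<^sup>2 * expectation (\<lambda>\<omega>. (?d i (Suc k) \<omega>)\<^sup>2)))"
    by (induction n) (simp_all add: moment)
  moreover have "0 \<le> expectation (\<lambda>\<omega>. (m 1 \<omega>)\<^sup>2)" by simp
  moreover have "expectation (\<lambda>\<omega>. (m (Suc n) \<omega>)\<^sup>2) \<le> 1"
  proof -
    have "m (Suc n) \<in> borel_measurable M" using meas by (intro measurable_of_history) auto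
    then have "integrable M (\<lambda>\<omega>. (m (Suc n) \<omega>)\<^sup>2)"
      using m_bounds by (intro integrable_bounded[of _ 1]) (auto intro: power_le_one)
    then have "expectation (\<lambda>\<omega>. (m (Suc n) \<omega>)\<^sup>2) \<le> expectation (\<lambda>\<omega>. 1)"
      using m_bounds by (intro integral_mono) (auto intro: power_le_one)
    then show ?thesis by (simp add: prob_space)
  qed
  \<comment> \<open>Of the nonnegative contributions of all agents, only that of agent
    \<open>i\<close> is kept.\<close>
  moreover have "(\<alpha> * p $ i)\<^sup>2 * (\<Sum>k<n. expectation (\<lambda>\<omega>. (?d i (Suc k) \<omega>)\<^sup>2)) \<le>
      (\<Sum>k<n. \<alpha>\<^sup>2 * (\<Sum>i\<in>UNIV. (p $ i)\<^sup>2 * expectation (\<lambda>\<omega>. (?d i (Suc k) \<omega>)\<^sup>2)))"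
    unfolding sum_distrib_left[of _ _ "{..<n}"] power_mult_distrib mult.assoc
    by (intro sum_mono mult_left_mono member_le_sum) auto
  ultimately show ?thesis by linarith
qed

text \<open>Since \<open>p $ i\<close> is positive, \<open>noise_variance_sum_le\<close> can be
  divided by its square. The squared noise of agent \<open>i\<close> is then summable in expectation
  and tends to 0 almost surely, which forces its action to settle. The limit may still depend on the
  agent.\<close>

lemma maximal_component_settles:
  assumes C: "maximal_component W C" and i: "i \<in> C"
  shows "AE \<omega> in M. \<exists>c\<in>{0, 1}. (\<lambda>t. x t \<omega> $ i) \<longlonglongrightarrow> c \<and> (\<forall>\<^sub>F t in sequentially. a t \<omega> $ i = c)"
proof -
  obtain p where p: "p v* W = p" "\<And>i. i \<in> C \<Longrightarrow> 0 < p $ i" "\<And>i. 0 \<le> p $ i" "(\<Sum>i\<in>UNIV. p $ i) = 1"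
    using stationary_weights_on_maximal_component[OF stochastic C] by blast
  let ?d = "\<lambda>n \<omega>. a (Suc n) \<omega> $ i - x (Suc n) \<omega> $ i"
  have "AE \<omega> in M. (\<lambda>n. (?d n \<omega>)\<^sup>2) \<longlonglongrightarrow> 0"
  proof (rule AE_tendsto_zero_of_bounded_expectation_sums[where K = "1 / (\<alpha> * p $ i)\<^sup>2"])
    show "integrable M (\<lambda>\<omega>. (?d n \<omega>)\<^sup>2)" for n
    proof (rule integrable_bounded)
      show "(\<lambda>\<omega>. (?d n \<omega>)\<^sup>2) \<in> borel_measurable M"
        using action_measurable[of "Suc n"] opinion_measurable[of "Suc n"] by simp
      show "\<bar>(?d n \<omega>)\<^sup>2\<bar> \<le> 1" if "\<omega> \<in> space M" for \<omega>
        using noise_bound[OF _ that, of "Suc n" i] by (simp add: abs_square_le_1)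
    qed
    show "(\<Sum>k<n. expectation (\<lambda>\<omega>. (?d k \<omega>)\<^sup>2)) \<le> 1 / (\<alpha> * p $ i)\<^sup>2" for n
      using noise_variance_sum_le[OF p(1,3,4), of i n] p(2)[OF i] alpha by (simp add: field_simps)
  qed simp
  then show ?thesis using AE_space
  proof eventually_elim
    case (elim \<omega>)
    have "(\<lambda>n. ?d n \<omega>) \<longlonglongrightarrow> 0"
      using tendsto_real_sqrt[OF elim(1)] by (simp add: tendsto_rabs_zero_iff)
    moreover have "a (Suc n) \<omega> $ i \<in> {0, 1}" for n using action_range[OF _ elim(2)] by simp
    ultimately obtain c where c: "c \<in> {0, 1}" "\<forall>\<^sub>F n in sequentially. a (Suc n) \<omega> $ i = c"
      "(\<lambda>n. x (Suc n) \<omega> $ i) \<longlonglongrightarrow> c"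
      using action_eventually_constant[OF alpha, of "\<lambda>n. a (Suc n) \<omega> $ i" "\<lambda>n. x (Suc n) \<omega> $ i"]
        update_bounds[OF _ elim(2), of "Suc _" i] by auto
    then show ?case
      using filterlim_sequentially_Suc[of "\<lambda>t. x t \<omega> $ i"] eventually_sequentially_Suc[of "\<lambda>t. a t \<omega> $ i = c"]
      by auto
  qed
qed

text \<open>The limits of the single agents are glued together: each is a \<open>W\<close>-average
  of 0/1 limits inside \<open>C\<close>, and such an average is 0 or 1 only if all limits with
  positive weight agree with it.\<close>

lemma maximal_component_consensus:
  assumes C: "maximal_component W C"
  shows "AE \<omega> in M. \<exists>c\<in>{0, 1}. \<forall>i\<in>C. (\<lambda>t. x t \<omega> $ i) \<longlonglongrightarrow> c \<and> (\<forall>\<^sub>F t in sequentially. a t \<omega> $ i = c)"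
proof -
  have "AE \<omega> in M. \<forall>i\<in>C. \<exists>c\<in>{0, 1}. (\<lambda>t. x t \<omega> $ i) \<longlonglongrightarrow> c \<and> (\<forall>\<^sub>F t in sequentially. a t \<omega> $ i = c)"
    using maximal_component_settles[OF C] by (intro AE_finite_allI) auto
  then show ?thesis using AE_space
  proof eventually_elim
    case (elim \<omega>)
    from bchoice[OF elim(1)[unfolded Bex_def]] obtain c
      where c: "\<And>i. i \<in> C \<Longrightarrow> c i \<in> {0, 1}" "\<And>i. i \<in> C \<Longrightarrow> (\<lambda>t. x t \<omega> $ i) \<longlonglongrightarrow> c i"
        "\<And>i. i \<in> C \<Longrightarrow> \<forall>\<^sub>F t in sequentially. a t \<omega> $ i = c i" by blast
    have W_out: "W $ i $ j = 0" if "i \<in> C" "j \<notin> C" for i j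
    proof -
      have "(j, i) \<notin> edges W" using maximal_component_closed[OF C] that by blast
      then show ?thesis using W_nonneg[of i j] by (simp add: edges_def)
    qed
    \<comment> \<open>The limit of the update equation, using that agents of \<open>C\<close> put no
      weight outside \<open>C\<close>.\<close>
    have harmonic: "c i = (\<Sum>j\<in>C. W $ i $ j * c j)" if i: "i \<in> C" for i
    proof -
      have "(\<lambda>t. (1 - \<alpha>) * x t \<omega> $ i + \<alpha> * (\<Sum>j\<in>C. W $ i $ j * a t \<omega> $ j))
          \<longlonglongrightarrow> (1 - \<alpha>) * c i + \<alpha> * (\<Sum>j\<in>C. W $ i $ j * c j)"
        using c(2)[OF i] tendsto_eventually[OF c(3)] by (intro tendsto_intros)
      moreover have "\<forall>\<^sub>F t in sequentially.
          (1 - \<alpha>) * x t \<omega> $ i + \<alpha> * (\<Sum>j\<in>C. W $ i $ j * a t \<omega> $ j) = x (Suc t) \<omega> $ i"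
        using eventually_ge_at_top[of 1]
      proof eventually_elim
        case (elim t)
        have "(\<Sum>j\<in>C. W $ i $ j * a t \<omega> $ j) = (\<Sum>j\<in>UNIV. W $ i $ j * a t \<omega> $ j)"
          using W_out[OF i] by (intro sum.mono_neutral_left) auto
        then show ?case using update_component[OF elim \<open>\<omega> \<in> space M\<close>, of i] by simp
      qed
      ultimately have "(\<lambda>t. x (Suc t) \<omega> $ i) \<longlonglongrightarrow> (1 - \<alpha>) * c i + \<alpha> * (\<Sum>j\<in>C. W $ i $ j * c j)"
        by (rule Lim_transform_eventually)
      moreover have "(\<lambda>t. x (Suc t) \<omega> $ i) \<longlonglongrightarrow> c i"
        using c(2)[OF i] by (rule LIMSEQ_Suc)
      ultimately have "(1 - \<alpha>) * c i + \<alpha> * (\<Sum>j\<in>C. W $ i $ j * c j) = c i"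
        by (rule LIMSEQ_unique)
      then have "\<alpha> * (\<Sum>j\<in>C. W $ i $ j * c j) = \<alpha> * c i" by (simp add: algebra_simps)
      then show ?thesis using alpha by simp
    qed
    have edge: "c j = c i" if e: "(j, i) \<in> edges W" and i: "i \<in> C" for i j
    proof -
      have "W $ i $ j \<noteq> 0" using e by (simp add: edges_def)
      then have j: "j \<in> C" using W_out[OF i] by blast
      have sum1: "(\<Sum>j\<in>C. W $ i $ j) = 1"
        using W_row_sum[of i] W_out[OF i] by (subst sum.mono_neutral_left[of UNIV C]) auto
      \<comment> \<open>The weighted variance about \<open>c i\<close>. For 0/1 values the square is
        linear in \<open>c j\<close>, so harmonicity reduces the sum to
        \<open>2 * c i * (1 - c i)\<close>, which is 0; every nonnegative term must then
        vanish.\<close>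
      have "(\<Sum>j\<in>C. W $ i $ j * (c i - c j)\<^sup>2) =
          (\<Sum>j\<in>C. c i * W $ i $ j + (1 - 2 * c i) * (W $ i $ j * c j))"
      proof (intro sum.cong refl)
        fix j assume "j \<in> C"
        then show "W $ i $ j * (c i - c j)\<^sup>2 = c i * W $ i $ j + (1 - 2 * c i) * (W $ i $ j * c j)"
          using c(1)[OF i] c(1)[of j] by auto
      qed
      also have "\<dots> = c i + (1 - 2 * c i) * c i"
        by (simp add: sum.distrib sum1 harmonic[OF i, symmetric] flip: sum_distrib_left)
      also have "\<dots> = 0" using c(1)[OF i] by auto
      finally have "(\<Sum>j\<in>C. W $ i $ j * (c i - c j)\<^sup>2) = 0" .
      then have "W $ i $ j * (c i - c j)\<^sup>2 = 0"
        using j W_nonneg by (subst (asm) sum_nonneg_eq_0_iff) auto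
      then show ?thesis using \<open>W $ i $ j \<noteq> 0\<close> by simp
    qed
    obtain i where i: "i \<in> C" using maximal_component_nonempty[OF C] by blast
    have "c j = c i" if "(j, i) \<in> (edges W)\<^sup>*" for j
      using that
    proof (induction rule: converse_rtrancl_induct)
      case (step j k)
      then have "k \<in> C" using maximal_component_closed[OF C i] by blast
      then show ?case using edge[OF step.hyps(1)] step.IH by simp
    qed simp
    then have "c j = c i" if "j \<in> C" for j
      using maximal_component_strongly_connected[OF C that i] by blast
    then show ?case using c i by (intro bexI[of _ "c i"]) metis+
  qed
qed

section \<open>Agents outside the maximal components\<close>

text \<open>On the event that all actions in \<open>R\<close> equal \<open>c\<close> from time \<open>T\<close> on, the expected distances to
  \<open>c\<close> outside \<open>R\<close> decay geometrically; summability upgrades this to almost sure convergence.\<close>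

lemma convergence_outside_settled_set:
  assumes reach: "\<And>i. \<exists>j\<in>R. (j, i) \<in> (edges W)\<^sup>*" and T: "1 \<le> T" and c: "c \<in> {0, 1}"
    and i: "i \<notin> R"
  shows "AE \<omega> in M. (\<forall>s\<ge>T. \<forall>j\<in>R. a s \<omega> $ j = c) \<longrightarrow> (\<lambda>t. x t \<omega> $ i) \<longlonglongrightarrow> c"
proof -
  obtain h \<delta> where \<delta>: "0 < \<delta>" "\<delta> < 1" and h_pos: "\<And>i. i \<notin> R \<Longrightarrow> 0 < h i"
    and h: "\<And>i. i \<notin> R \<Longrightarrow> (\<Sum>j\<in>-R. W $ i $ j * h j) \<le> (1 - \<delta>) * h i"
    by (rule contracting_weights_outside[OF stochastic reach]) (rule that)
  \<comment> \<open>The distances of opinion and action from \<open>c\<close>: the reflection is the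
    identity for \<open>c = 0\<close> and \<open>1 - x\<close> for \<open>c = 1\<close>, which
    treats both cases at once.\<close>
  define y where "y t i \<omega> = c + (1 - 2 * c) * x t \<omega> $ i" for t i \<omega>
  define b where "b t i \<omega> = c + (1 - 2 * c) * a t \<omega> $ i" for t i \<omega>
  \<comment> \<open>Only actions before time \<open>t\<close> are inspected, so \<open>G t\<close>
    is known to the history at \<open>t\<close>, unlike the event of being settled forever.\<close>
  define G :: "nat \<Rightarrow> 'w \<Rightarrow> real" where
    "G t = indicator {\<omega> \<in> space M. \<forall>s\<in>{T..<t}. \<forall>j\<in>R. a s \<omega> $ j = c}" for t
  define e where "e t i = expectation (\<lambda>\<omega>. G t \<omega> * y t i \<omega>)" for t i
  have G01: "0 \<le> G t \<omega>" "G t \<omega> \<le> 1" "\<bar>G t \<omega>\<bar> \<le> 1" for t \<omega> by (auto simp: G_def indicator_def)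
  have y01: "0 \<le> y t j \<omega>" "y t j \<omega> \<le> 1" if "1 \<le> t" "\<omega> \<in> space M" for t j \<omega>
    using opinion_bounds[OF that, of j] c by (auto simp: y_def)
  have b01: "0 \<le> b t j \<omega>" "b t j \<omega> \<le> 1" if "1 \<le> t" "\<omega> \<in> space M" for t j \<omega>
    using action_bounds[OF that, of j] c by (auto simp: b_def)
  have G_hist: "G t \<in> borel_measurable (history M x a t)" for t
  proof -
    have "{\<omega> \<in> space (history M x a t). \<forall>s\<in>{T..<t}. \<forall>j\<in>R. a s \<omega> $ j = c} \<in> sets (history M x a t)"
    proof (intro sets.sets_Collect_finite_All)
      fix s j assume "s \<in> {T..<t}"
      then have "a s \<in> borel_measurable (history M x a t)"
        using T by (intro action_measurable_history) auto
      then show "{\<omega> \<in> space (history M x a t). a s \<omega> $ j = c} \<in> sets (history M x a t)"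
        by measurable
    qed auto
    then show ?thesis unfolding G_def by simp
  qed
  have [measurable]: "G t \<in> borel_measurable M" for t by (rule measurable_of_history[OF G_hist])
  have y_meas[measurable]: "y t j \<in> borel_measurable M" if "1 \<le> t" for t j
    using opinion_measurable[OF that] unfolding y_def by simp
  have b_meas[measurable]: "b t j \<in> borel_measurable M" if "1 \<le> t" for t j
    using action_measurable[OF that] unfolding b_def by simp
  have int: "integrable M (\<lambda>\<omega>. G t \<omega> * u \<omega>)"
    if "u \<in> borel_measurable M" "\<And>\<omega>. \<omega> \<in> space M \<Longrightarrow> \<bar>u \<omega>\<bar> \<le> 1" for t u
    using that G01 by (intro integrable_bounded[of _ 1]) (auto simp: abs_mult intro: mult_le_one)
  have int_y: "integrable M (\<lambda>\<omega>. G t \<omega> * y t j \<omega>)" if "1 \<le> t" for t j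
    using that y01 by (intro int) auto
  have int_b: "integrable M (\<lambda>\<omega>. G t \<omega> * b t j \<omega>)" if "1 \<le> t" for t j
    using that b01 by (intro int) auto
  \<comment> \<open>Given the history, the mean of the action is the opinion, and the reflection is
    affine.\<close>
  have Gb: "expectation (\<lambda>\<omega>. G t \<omega> * b t j \<omega>) = e t j" if t: "1 \<le> t" for t j
  proof -
    have intG: "integrable M (G t)" using G01 by (intro integrable_bounded[of _ 1]) auto
    have inta: "integrable M (\<lambda>\<omega>. G t \<omega> * a t \<omega> $ j)"
      using action_bounds[OF t] action_measurable[OF t] by (intro int) auto
    have intx: "integrable M (\<lambda>\<omega>. G t \<omega> * x t \<omega> $ j)"
      using opinion_bounds[OF t] opinion_measurable[OF t] by (intro int) auto
    have "expectation (\<lambda>\<omega>. G t \<omega> * b t j \<omega>) =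
        expectation (\<lambda>\<omega>. c * G t \<omega> + (1 - 2 * c) * (G t \<omega> * a t \<omega> $ j))"
      unfolding b_def by (intro Bochner_Integration.integral_cong) (auto simp: algebra_simps)
    also have "\<dots> = expectation (\<lambda>\<omega>. c * G t \<omega> + (1 - 2 * c) * (G t \<omega> * x t \<omega> $ j))"
      using intG inta intx expectation_times_action[OF t G_hist G01(3), of j]
      by (simp add: Bochner_Integration.integral_add)
    also have "\<dots> = e t j"
      unfolding e_def y_def by (intro Bochner_Integration.integral_cong) (auto simp: algebra_simps)
    finally show ?thesis .
  qed
  \<comment> \<open>Where \<open>G (Suc t)\<close> is 1, the actions of \<open>R\<close> at
    \<open>t\<close> already equal \<open>c\<close> and contribute no distance, so only agents
    outside \<open>R\<close> remain in the sum.\<close>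
  have step: "e (Suc t) k \<le> (1 - \<alpha>) * e t k + \<alpha> * (\<Sum>j\<in>-R. W $ k $ j * e t j)" if t: "T \<le> t" for t k
  proof -
    have t1: "1 \<le> t" using t T by simp
    let ?u = "\<lambda>\<omega>. (1 - \<alpha>) * (G t \<omega> * y t k \<omega>) + \<alpha> * (\<Sum>j\<in>-R. W $ k $ j * (G t \<omega> * b t j \<omega>))"
    have "e (Suc t) k \<le> expectation ?u"
      unfolding e_def
    proof (rule integral_mono)
      show "integrable M (\<lambda>\<omega>. G (Suc t) \<omega> * y (Suc t) k \<omega>)" by (rule int_y) simp
      show "integrable M ?u" using int_y[OF t1] int_b[OF t1] by simp
      fix \<omega> assume \<omega>: "\<omega> \<in> space M"
      show "G (Suc t) \<omega> * y (Suc t) k \<omega> \<le> ?u \<omega>"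
      proof (cases "G (Suc t) \<omega> = 0")
        case True
        have "0 \<le> ?u \<omega>"
          using alpha G01 y01[OF t1 \<omega>] b01[OF t1 \<omega>] W_nonneg
          by (intro add_nonneg_nonneg mult_nonneg_nonneg sum_nonneg) auto
        then show ?thesis using True by simp
      next
        case False
        then have settled: "\<forall>s\<in>{T..<Suc t}. \<forall>j\<in>R. a s \<omega> $ j = c"
          by (auto simp: G_def indicator_def split: if_splits)
        then have G1: "G (Suc t) \<omega> = 1" "G t \<omega> = 1" using \<omega> by (auto simp: G_def)
        have b0: "b t j \<omega> = 0" if "j \<in> R" for j
          using settled t c that by (auto simp: b_def)
        have "y (Suc t) k \<omega> = (1 - \<alpha>) * y t k \<omega> + \<alpha> * (\<Sum>j\<in>UNIV. W $ k $ j * b t j \<omega>)"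
        proof -
          have "(\<Sum>j\<in>UNIV. W $ k $ j * b t j \<omega>) = c + (1 - 2 * c) * (\<Sum>j\<in>UNIV. W $ k $ j * a t \<omega> $ j)"
          proof -
            have "(\<Sum>j\<in>UNIV. W $ k $ j * b t j \<omega>) =
                (\<Sum>j\<in>UNIV. W $ k $ j * c + (1 - 2 * c) * (W $ k $ j * a t \<omega> $ j))"
              unfolding b_def by (intro sum.cong) (auto simp: algebra_simps)
            then show ?thesis
              by (simp add: sum.distrib W_row_sum flip: sum_distrib_left sum_distrib_right)
          qed
          then show ?thesis
            unfolding y_def update_component[OF t1 \<omega>] by algebra
        qed
        also have "(\<Sum>j\<in>UNIV. W $ k $ j * b t j \<omega>) = (\<Sum>j\<in>-R. W $ k $ j * b t j \<omega>)"
          using b0 by (intro sum.mono_neutral_right) auto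
        finally show ?thesis by (simp add: G1)
      qed
    qed
    also have "expectation ?u = (1 - \<alpha>) * e t k + \<alpha> * (\<Sum>j\<in>-R. W $ k $ j * e t j)"
      using int_y[OF t1] int_b[OF t1] by (simp add: Gb[OF t1]) (simp add: e_def)
    finally show ?thesis .
  qed
  \<comment> \<open>Chosen so that \<open>K * h\<close> dominates 1 outside \<open>R\<close>, and
    hence the initial expected distances.\<close>
  define K where "K = (\<Sum>i\<in>-R. 1 / h i)"
  have K: "1 \<le> K * h k" if k: "k \<notin> R" for k
  proof -
    have "1 / h k \<le> K"
      unfolding K_def using k by (intro member_le_sum) (auto intro: less_imp_le[OF h_pos])
    then show ?thesis using h_pos[OF k] by (simp add: field_simps)
  qed
  have K0: "0 \<le> K" unfolding K_def by (intro sum_nonneg) (auto intro: less_imp_le[OF h_pos])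
  \<comment> \<open>The contraction factor \<open>(1 - \<alpha>) + \<alpha> * (1 - \<delta>)\<close>
    of one update acting on multiples of \<open>h\<close>.\<close>
  define q where "q = 1 - \<alpha> * \<delta>"
  have q: "0 \<le> q" "q < 1"
    using alpha \<delta> mult_le_one[of \<alpha> \<delta>] by (auto simp: q_def)
  have decay: "e (T + n) k \<le> K * q ^ n * h k" if "k \<notin> R" for n k
    using that
  proof (induction n arbitrary: k)
    case 0
    have "e T k \<le> expectation (\<lambda>\<omega>. 1)"
      unfolding e_def using int_y[OF T] y01[OF T] G01
      by (intro integral_mono) (auto intro: mult_le_one)
    then show ?case using K[OF 0] by (simp add: prob_space)
  next
    case (Suc n)
    have "e (T + Suc n) k \<le> (1 - \<alpha>) * e (T + n) k + \<alpha> * (\<Sum>j\<in>-R. W $ k $ j * e (T + n) j)"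
      using step[of "T + n" k] by simp
    also have "\<dots> \<le> (1 - \<alpha>) * (K * q ^ n * h k) + \<alpha> * (\<Sum>j\<in>-R. W $ k $ j * (K * q ^ n * h j))"
      using Suc alpha W_nonneg by (intro add_mono mult_left_mono sum_mono) auto
    also have "(\<Sum>j\<in>-R. W $ k $ j * (K * q ^ n * h j)) = K * q ^ n * (\<Sum>j\<in>-R. W $ k $ j * h j)"
      by (simp add: sum_distrib_left mult_ac)
    also have "(1 - \<alpha>) * (K * q ^ n * h k) + \<alpha> * (K * q ^ n * (\<Sum>j\<in>-R. W $ k $ j * h j)) \<le>
        (1 - \<alpha>) * (K * q ^ n * h k) + \<alpha> * (K * q ^ n * ((1 - \<delta>) * h k))"
      using alpha K0 q h[OF Suc.prems] by (intro add_left_mono mult_left_mono) auto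
    also have "\<dots> = K * q ^ Suc n * h k" by (simp add: q_def algebra_simps)
    finally show ?case .
  qed
  have "AE \<omega> in M. (\<lambda>n. G (T + n) \<omega> * y (T + n) i \<omega>) \<longlonglongrightarrow> 0"
  proof (rule AE_tendsto_zero_of_bounded_expectation_sums[where K = "K * h i / (1 - q)"])
    show "integrable M (\<lambda>\<omega>. G (T + n) \<omega> * y (T + n) i \<omega>)" for n using T by (intro int_y) simp
    show "0 \<le> G (T + n) \<omega> * y (T + n) i \<omega>" if "\<omega> \<in> space M" for n \<omega>
      using G01 y01[OF _ that] T by simp
    show "(\<Sum>k<n. expectation (\<lambda>\<omega>. G (T + k) \<omega> * y (T + k) i \<omega>)) \<le> K * h i / (1 - q)" for n
    proof -
      have "(\<Sum>k<n. expectation (\<lambda>\<omega>. G (T + k) \<omega> * y (T + k) i \<omega>)) \<le> (\<Sum>k<n. K * q ^ k * h i)"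
        using decay[OF i] by (intro sum_mono) (simp add: e_def)
      also have "\<dots> = K * h i * (\<Sum>k<n. q ^ k)" by (simp add: sum_distrib_left mult_ac)
      also have "\<dots> \<le> K * h i * (1 / (1 - q))"
        using q K0 h_pos[OF i] by (intro mult_left_mono) (auto simp: sum_gp_strict divide_right_mono)
      finally show ?thesis by simp
    qed
  qed
  then show ?thesis using AE_space
  proof eventually_elim
    case (elim \<omega>)
    show ?case
    proof
      assume settled: "\<forall>s\<ge>T. \<forall>j\<in>R. a s \<omega> $ j = c"
      then have "G (T + n) \<omega> = 1" for n using elim(2) by (auto simp: G_def)
      then have "(\<lambda>n. y (T + n) i \<omega>) \<longlonglongrightarrow> 0" using elim(1) by simp
      \<comment> \<open>The reflection is its own inverse for \<open>c\<close> in
        \<open>{0, 1}\<close>, so applying it to \<open>y\<close> gives back the opinion.\<close>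
      from tendsto_add[OF tendsto_const[of c] tendsto_mult_left[OF this, of "1 - 2 * c"]]
      have "(\<lambda>n. x (n + T) \<omega> $ i) \<longlonglongrightarrow> c"
        using c by (auto simp: y_def add.commute)
      then show "(\<lambda>t. x t \<omega> $ i) \<longlonglongrightarrow> c" by (rule LIMSEQ_offset)
    qed
  qed
qed

text \<open>The union \<open>R\<close> of the maximal components reaches every agent. If its limits
  agree, its finitely many agents all act as the common value from some time on, and the agents
  outside \<open>R\<close> follow.\<close>

lemma consensus_of_maximal_components:
  assumes "AE \<omega> in M. \<exists>c. \<forall>C. maximal_component W C \<longrightarrow> (\<forall>i\<in>C. (\<lambda>t. x t \<omega> $ i) \<longlonglongrightarrow> c)"
  shows "AE \<omega> in M. \<exists>c\<in>{0, 1}. \<forall>i. (\<lambda>t. x t \<omega> $ i) \<longlonglongrightarrow> c"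
proof -
  define R where "R = \<Union>{C. maximal_component W C}"
  have reach: "\<exists>j\<in>R. (j, i) \<in> (edges W)\<^sup>*" for i
    using reachable_from_maximal_component[of W i] unfolding R_def by blast
  have "AE \<omega> in M. \<forall>C\<in>{C. maximal_component W C}. \<exists>c\<in>{0, 1}. \<forall>i\<in>C.
      (\<lambda>t. x t \<omega> $ i) \<longlonglongrightarrow> c \<and> (\<forall>\<^sub>F t in sequentially. a t \<omega> $ i = c)"
    using maximal_component_consensus by (intro AE_finite_allI) auto
  \<comment> \<open>The settling time and value depend on \<open>\<omega>\<close>; one almost sure
    event is therefore secured for all countably many \<open>T\<close> and both values.\<close>
  moreover have "AE \<omega> in M. \<forall>T. \<forall>c\<in>{0, 1}. \<forall>i\<in>-R.
      1 \<le> T \<longrightarrow> (\<forall>s\<ge>T. \<forall>j\<in>R. a s \<omega> $ j = c) \<longrightarrow> (\<lambda>t. x t \<omega> $ i) \<longlonglongrightarrow> c"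
    using convergence_outside_settled_set[OF reach]
    by (subst AE_all_countable, intro allI AE_finite_allI, auto)
  ultimately show ?thesis using assms
  proof eventually_elim
    case (elim \<omega>)
    from elim(3) obtain c where c: "\<And>i. i \<in> R \<Longrightarrow> (\<lambda>t. x t \<omega> $ i) \<longlonglongrightarrow> c"
      unfolding R_def by blast
    have settle: "c \<in> {0, 1} \<and> (\<forall>\<^sub>F t in sequentially. a t \<omega> $ i = c)" if i: "i \<in> R" for i
    proof -
      obtain d where "d \<in> {0, 1}" "(\<lambda>t. x t \<omega> $ i) \<longlonglongrightarrow> d" "\<forall>\<^sub>F t in sequentially. a t \<omega> $ i = d"
        using elim(1) i unfolding R_def by blast
      then show ?thesis using LIMSEQ_unique[OF c[OF i]] by blast
    qed
    \<comment> \<open>\<open>c\<close> was only some real number; as \<open>R\<close> is nonempty,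
      it is the 0/1 limit of one of its agents.\<close>
    have c01: "c \<in> {0, 1}" using settle reach by blast
    have "\<forall>\<^sub>F t in sequentially. \<forall>i\<in>R. a t \<omega> $ i = c"
      using settle by (subst eventually_ball_finite_distrib) auto
    then obtain T where "\<forall>s\<ge>T. \<forall>j\<in>R. a s \<omega> $ j = c" by (auto simp: eventually_sequentially)
    then have T: "\<forall>s\<ge>Suc T. \<forall>j\<in>R. a s \<omega> $ j = c" by auto
    have "(\<lambda>t. x t \<omega> $ i) \<longlonglongrightarrow> c" if "i \<notin> R" for i
    proof -
      have "i \<in> -R" using that by simp
      from bspec[OF bspec[OF spec[OF elim(2)] c01] this, THEN mp, THEN mp, OF _ T]
      show ?thesis by simp
    qed
    then show ?case using c c01 by blast
  qed
qed

end

section \<open>Measurable limit vector and the equivalence\<close>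

theorem theorem2:
  fixes M :: "'w measure" and \<alpha> :: real and W :: "real ^ 'n ^ 'n"
    and x a :: "nat \<Rightarrow> 'w \<Rightarrow> real ^ 'n"
  assumes "random_actions M \<alpha> W x a"
  shows "(\<forall>C. maximal_component W C \<longrightarrow>
            (AE \<omega> in M. \<exists>c\<in>{0, 1}. \<forall>i\<in>C. (\<lambda>t. x t \<omega> $ i) \<longlonglongrightarrow> c)) \<and>
         ((\<exists>xinf\<in>borel_measurable M.
             (\<forall>\<omega>\<in>space M. xinf \<omega> \<in> {vec 0, vec 1}) \<and>
             (AE \<omega> in M. (\<lambda>t. x t \<omega>) \<longlonglongrightarrow> xinf \<omega>))
          \<longleftrightarrow>
          (AE \<omega> in M. \<exists>c. \<forall>C. maximal_component W C \<longrightarrow>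
             (\<forall>i\<in>C. (\<lambda>t. x t \<omega> $ i) \<longlonglongrightarrow> c)))"
proof -
  interpret random_actions M \<alpha> W x a by fact
  have settled: "AE \<omega> in M. \<exists>c\<in>{0, 1}. \<forall>i\<in>C. (\<lambda>t. x t \<omega> $ i) \<longlonglongrightarrow> c" if "maximal_component W C" for C
    using maximal_component_consensus[OF that] by eventually_elim blast
  show ?thesis
  proof (intro conjI allI impI iffI)
    fix C assume "maximal_component W C"
    then show "AE \<omega> in M. \<exists>c\<in>{0, 1}. \<forall>i\<in>C. (\<lambda>t. x t \<omega> $ i) \<longlonglongrightarrow> c" by (rule settled)
  next
    assume "\<exists>xinf\<in>borel_measurable M. (\<forall>\<omega>\<in>space M. xinf \<omega> \<in> {vec 0, vec 1}) \<and>
      (AE \<omega> in M. (\<lambda>t. x t \<omega>) \<longlonglongrightarrow> xinf \<omega>)"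
    then obtain xinf where xinf: "\<forall>\<omega>\<in>space M. xinf \<omega> \<in> {vec 0, vec 1}"
      and lim: "AE \<omega> in M. (\<lambda>t. x t \<omega>) \<longlonglongrightarrow> xinf \<omega>" by blast
    from lim AE_space show "AE \<omega> in M. \<exists>c. \<forall>C. maximal_component W C \<longrightarrow> (\<forall>i\<in>C. (\<lambda>t. x t \<omega> $ i) \<longlonglongrightarrow> c)"
    proof eventually_elim
      case (elim \<omega>)
      obtain c :: real where "xinf \<omega> = vec c" using xinf elim(2) by blast
      then have "(\<lambda>t. x t \<omega> $ i) \<longlonglongrightarrow> c" for i using tendsto_vec_nth[OF elim(1), of i] by simp
      then show ?case by blast
    qed
  next
    assume "AE \<omega> in M. \<exists>c. \<forall>C. maximal_component W C \<longrightarrow> (\<forall>i\<in>C. (\<lambda>t. x t \<omega> $ i) \<longlonglongrightarrow> c)"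
    then have consensus: "AE \<omega> in M. \<exists>c\<in>{0, 1}. \<forall>i. (\<lambda>t. x t \<omega> $ i) \<longlonglongrightarrow> c"
      by (rule consensus_of_maximal_components)
    \<comment> \<open>Under consensus the limit of any one agent determines the whole limit vector,
      so an arbitrary agent serves.\<close>
    define i0 :: 'n where "i0 = undefined"
    \<comment> \<open>\<open>lim\<close> is total, which gives a measurable function on the whole
      space; the shift by \<open>Suc\<close> keeps to times from 1 on.\<close>
    define g where "g \<omega> = lim (\<lambda>t. x (Suc t) \<omega> $ i0)" for \<omega>
    \<comment> \<open>The case split forces one of the two allowed values at every
      \<open>\<omega>\<close>, also on the null set without consensus.\<close>
    define xinf :: "'w \<Rightarrow> real ^ 'n" where "xinf \<omega> = (if g \<omega> = 1 then vec 1 else vec 0)" for \<omega>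
    have "(\<lambda>\<omega>. x (Suc t) \<omega> $ i0) \<in> borel_measurable M" for t
      by (intro vec_nth_measurable opinion_measurable) simp
    then have [measurable]: "g \<in> borel_measurable M"
      unfolding g_def by (rule borel_measurable_lim_metric)
    have "xinf \<in> borel_measurable M" unfolding xinf_def by measurable
    moreover have "\<forall>\<omega>\<in>space M. xinf \<omega> \<in> {vec 0, vec 1}" by (simp add: xinf_def)
    moreover from consensus have "AE \<omega> in M. (\<lambda>t. x t \<omega>) \<longlonglongrightarrow> xinf \<omega>"
    proof eventually_elim
      case (elim \<omega>)
      then obtain c where c: "c \<in> {0, 1}" "\<And>i. (\<lambda>t. x t \<omega> $ i) \<longlonglongrightarrow> c" by blast
      have "g \<omega> = c" unfolding g_def by (rule limI[OF LIMSEQ_Suc[OF c(2)]])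
      then have "xinf \<omega> $ i = c" for i using c(1) by (auto simp: xinf_def)
      then show ?case using c(2) by (intro vec_tendstoI) simp
    qed
    ultimately show "\<exists>xinf\<in>borel_measurable M. (\<forall>\<omega>\<in>space M. xinf \<omega> \<in> {vec 0, vec 1}) \<and>
      (AE \<omega> in M. (\<lambda>t. x t \<omega>) \<longlonglongrightarrow> xinf \<omega>)" by blast
  qed
qed

end
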